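(* Let $r>1$, $a>0$ and $t_k=\frac{k^r-1+a}{a}$ for $k\ge1$. Suppose that Assumption $A_1$ (local error bound condition) holds, let $(x_k)$ be generated by the Inertial Forward-Backward algorithm with this $(t_k)$, and let $x_*\in X$. Then, as $k\to\infty$: 1) $F(x_k)-F(x_* )=o\left(\frac{1}{k^{2r}}\right)$ and $\|x_k-x_{k-1}\|=O\left(\frac{1}{k^r}\right)$. 2) $(x_k)$ converges (in norm) to some $\bar x\in X$, with rate $\|x_k-\bar x\|=O\left(\frac{1}{k^{r-1}}\right)$.
   Context: Setting. $H$ is a real Hilbert space; $f:H\to\mathbb{R}$ is convex and continuously differentiable with $L_f$-Lipschitz continuous gradient ($L_f>0$); $g:H\to\mathbb{R}\cup\{+\infty\}$ is proper, lower semicontinuous and convex; $F:=f+g$. It is assumed that $X:=\arg\min F\neq\emptyset$, and $F_*:=\min F=F(x_* )$ for $x_*\in X$. For $\lambda>0$, $\mathrm{prox}_{\lambda g}(z):=\arg\min_{x\in H}\{g(x)+\frac{1}{2\lambda}\|x-z\|^2\}$ and $T_\lambda(x):=\mathrm{prox}_{\lambda g}(x-\lambda\nabla f(x))$. Inertial Forward-Backward algorithm (IFB). Fix $\mu\in(0,1)$, $\lambda=\mu/L_f$, a starting point $x_0\in H$, $y_1=x_0$, and the sequence $(t_k)_{k\ge1}$ (with $t_1=1$). For $k\ge1$: $x_k=T_\lambda(y_k)$ and $y_{k+1}=x_k+\gamma_k(x_k-x_{k-1})$, where $\gamma_k=\frac{t_k-1}{t_{k+1}}$. Assumption $A_1$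 (local error bound condition): for any $\xi\ge F_*$ there exist $\varepsilon>0$ and $\bar\tau>0$ such that $\mathrm{dist}(x,X)\le\bar\tau\,\|T_{1/L_f}(x)-x\|$ whenever $\|T_{1/L_f}(x)-x\|<\varepsilon$ and $F(x)\le\xi$. *)

theory Defs
  imports "HOL-Analysis.Analysis" "HOL-Library.Landau_Symbols"
begin

text \<open>
  Functions with values in \<open>\<real> \<union> {+\<infinity>}\<close> are rendered as \<^typ>\<open>ereal\<close>-valued functions; properness
  excludes the value \<open>-\<infinity>\<close>.
\<close>

definition proper_fun :: "('a \<Rightarrow> ereal) \<Rightarrow> bool" where
  "proper_fun g \<longleftrightarrow> (\<forall>x. g x \<noteq> -\<infinity>) \<and> (\<exists>x. g x \<noteq> \<infinity>)"

definition lsc_fun :: "('a::topological_space \<Rightarrow> ereal) \<Rightarrow> bool" where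
  "lsc_fun g \<longleftrightarrow> (\<forall>x. g x \<le> Liminf (nhds x) g)"

text \<open>The convention \<open>0 * \<infinity> = 0\<close> of \<^typ>\<open>ereal\<close> makes the cases \<open>u = 0\<close> and \<open>v = 0\<close> harmless.\<close>

definition convex_fun :: "('a::real_vector \<Rightarrow> ereal) \<Rightarrow> bool" where
  "convex_fun g \<longleftrightarrow> (\<forall>x y. \<forall>u\<ge>0. \<forall>v\<ge>0. u + v = 1 \<longrightarrow>
     g (u *\<^sub>R x + v *\<^sub>R y) \<le> ereal u * g x + ereal v * g y)"

definition objective :: "('a \<Rightarrow> real) \<Rightarrow> ('a \<Rightarrow> ereal) \<Rightarrow> 'a \<Rightarrow> ereal" where
  "objective f g x = ereal (f x) + g x"

definition minimizers :: "('a \<Rightarrow> ereal) \<Rightarrow> 'a set" where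
  "minimizers F = {x. is_arg_min F (\<lambda>_. True) x}"

text \<open>
  \<^const>\<open>arg_min\<close> selects some minimizer; for proper, lower semicontinuous, convex \<open>g\<close> on a Hilbert
  space and \<open>lam > 0\<close> the minimizer exists and is unique.
\<close>

definition prox :: "('a::real_normed_vector \<Rightarrow> ereal) \<Rightarrow> real \<Rightarrow> 'a \<Rightarrow> 'a" where
  "prox g lam z =
     arg_min (\<lambda>x. g x + ereal (1 / (2 * lam) * (norm (x - z))\<^sup>2)) (\<lambda>_. True)"

text \<open>In the following definitions \<open>df\<close> stands for the gradient of \<open>f\<close>.\<close>

definition fb_step ::
  "('a::real_normed_vector \<Rightarrow> 'a) \<Rightarrow> ('a \<Rightarrow> ereal) \<Rightarrow> real \<Rightarrow> 'a \<Rightarrow> 'a" where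
  "fb_step df g lam x = prox g lam (x - lam *\<^sub>R df x)"

text \<open>The starting point is \<open>x 0\<close>; the value \<open>y 0\<close> is irrelevant.\<close>

definition inertial_fb ::
  "('a::real_normed_vector \<Rightarrow> 'a) \<Rightarrow> ('a \<Rightarrow> ereal) \<Rightarrow> real \<Rightarrow> (nat \<Rightarrow> real)
    \<Rightarrow> (nat \<Rightarrow> 'a) \<Rightarrow> (nat \<Rightarrow> 'a) \<Rightarrow> bool" where
  "inertial_fb df g lam t x y \<longleftrightarrow>
     y 1 = x 0 \<and>
     (\<forall>k\<ge>1. x k = fb_step df g lam (y k) \<and>
            y (k + 1) = x k + ((t k - 1) / t (k + 1)) *\<^sub>R (x k - x (k - 1)))"

text \<open>Here \<^term>\<open>Inf (range F)\<close> is the minimal value of \<open>F\<close>, attained as soon as \<^term>\<open>minimizers F\<close>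
  is nonempty.\<close>

definition local_error_bound ::
  "('a::real_normed_vector \<Rightarrow> real) \<Rightarrow> ('a \<Rightarrow> 'a) \<Rightarrow> ('a \<Rightarrow> ereal) \<Rightarrow> real \<Rightarrow> bool" where
  "local_error_bound f df g L \<longleftrightarrow>
     (let F = objective f g; T = fb_step df g (1 / L) in
      \<forall>\<xi>::real. ereal \<xi> \<ge> Inf (range F) \<longrightarrow>
        (\<exists>\<epsilon>>0. \<exists>\<tau>>0. \<forall>x. norm (T x - x) < \<epsilon> \<and> F x \<le> ereal \<xi> \<longrightarrow>
           infdist x (minimizers F) \<le> \<tau> * norm (T x - x)))"

end

theory Submission
  imports Defs "HOL-Real_Asymp.Real_Asymp"
begin

text \<open>
  Write \<open>w k = F (x k) - F xstar\<close>, \<open>\<delta> k = (norm (x k - x (k - 1)))\<^sup>2 / (2 * lam)\<close> and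
  \<open>d k = (norm (x k - y k))\<^sup>2\<close>. The forward-backward inequality at \<open>x k\<close> gives
  \<open>w (k + 1) + \<delta> (k + 1) + c * d (k + 1) \<le> w k + (\<gamma> k)\<^sup>2 * \<delta> k\<close>, where \<open>c > 0\<close> because \<open>\<mu> < 1\<close>;
  in particular \<open>d\<close> tends to \<open>0\<close>, so the error bound is eventually available. It bounds the distance
  of \<open>x k\<close> to the minimizers by a multiple of \<open>norm (x k - y k)\<close>, and the forward-backward inequality
  at nearly closest minimizers turns this into \<open>w k \<le> C * d k\<close>. Hence, with \<open>\<kappa> = c / C\<close>,
  \<open>(1 + \<kappa>) * w (k + 1) + \<delta> (k + 1) \<le> w k + (\<gamma> k)\<^sup>2 * \<delta> k\<close>. After multiplication by
  \<open>(t (k + 1))\<^sup>2\<close> the gain \<open>1 + \<kappa>\<close> absorbs the ratio \<open>(t (k + 1) / t k)\<^sup>2\<close>, which tends to \<open>1\<close>, so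
  \<open>(t k)\<^sup>2 * w k\<close> is summable and \<open>(t k)\<^sup>2 * \<delta> k\<close> is bounded. As \<open>r > 1\<close>, the increments of \<open>x\<close> are
  summable with tail of order \<open>k powr (1 - r)\<close>.
\<close>

section \<open>First-order bounds for smooth and convex functions\<close>

lemma GDERIV_imp_has_real_derivative_line:
  fixes f :: "'a::real_inner \<Rightarrow> real"
  assumes "\<And>z. GDERIV f z :> df z"
  shows "((\<lambda>s. f (y + s *\<^sub>R h)) has_real_derivative df (y + s *\<^sub>R h) \<bullet> h) (at s)"
proof -
  have "(f has_derivative (\<lambda>h'. h' \<bullet> df (y + s *\<^sub>R h))) (at (y + s *\<^sub>R h))"
    using assms by (simp add: gderiv_def)
  moreover have "((\<lambda>s. y + s *\<^sub>R h) has_derivative (\<lambda>s. s *\<^sub>R h)) (at s)"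
    by (auto intro!: derivative_eq_intros)
  ultimately have "((\<lambda>s. f (y + s *\<^sub>R h)) has_derivative (\<lambda>s'. (s' *\<^sub>R h) \<bullet> df (y + s *\<^sub>R h))) (at s)"
    by (rule has_derivative_compose[rotated])
  then show ?thesis
    by (simp add: has_field_derivative_def inner_commute mult_commute_abs)
qed

text \<open>The gap \<open>\<psi>\<close> between \<open>f\<close> and its quadratic model along the
  segment from \<open>y\<close> to \<open>x\<close> is nonincreasing: by Cauchy-Schwarz and the
  Lipschitz bound its derivative is at most 0.\<close>

lemma descent_lemma:
  fixes f :: "'a::real_inner \<Rightarrow> real"
  assumes grad: "\<And>z. GDERIV f z :> df z" and lip: "L-lipschitz_on UNIV df"
  shows "f x \<le> f y + df y \<bullet> (x - y) + L / 2 * (norm (x - y))\<^sup>2"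
proof -
  define h where "h = x - y"
  define \<psi> where "\<psi> s = f (y + s *\<^sub>R h) - s * (df y \<bullet> h) - L / 2 * s\<^sup>2 * (norm h)\<^sup>2" for s
  have "\<psi> 1 \<le> \<psi> 0"
  proof (rule DERIV_nonpos_imp_nonincreasing[of 0 1 \<psi>])
    fix s :: real assume s: "0 \<le> s" "s \<le> 1"
    let ?d = "df (y + s *\<^sub>R h) \<bullet> h - df y \<bullet> h - L * s * (norm h)\<^sup>2"
    have "(\<psi> has_real_derivative ?d) (at s)"
      unfolding \<psi>_def
      by (auto intro!: derivative_eq_intros GDERIV_imp_has_real_derivative_line[OF grad])
    moreover have "?d \<le> 0"
    proof -
      have "df (y + s *\<^sub>R h) \<bullet> h - df y \<bullet> h \<le> norm (df (y + s *\<^sub>R h) - df y) * norm h"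
        by (metis inner_diff_left norm_cauchy_schwarz)
      also have "\<dots> \<le> (L * norm (s *\<^sub>R h)) * norm h"
        using lipschitz_onD[OF lip, of "y + s *\<^sub>R h" y]
        by (intro mult_right_mono) (auto simp: dist_norm)
      finally show ?thesis using s by (simp add: power2_eq_square)
    qed
    ultimately show "\<exists>d. (\<psi> has_real_derivative d) (at s) \<and> d \<le> 0" by blast
  qed simp
  then show ?thesis by (simp add: \<psi>_def h_def)
qed

text \<open>Every first-order condition below comes from moving a fraction \<open>s\<close> along a
  segment and dividing by \<open>s\<close>; this is the concluding limit as \<open>s\<close>
  decreases to 0.\<close>

lemma affine_nonneg_at_0:
  fixes A B :: real
  assumes "\<And>s. 0 < s \<Longrightarrow> s \<le> 1 \<Longrightarrow> 0 \<le> A + s * B"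
  shows "0 \<le> A"
proof -
  have "((\<lambda>s. A + s * B) \<longlongrightarrow> A + 0 * B) (at_right 0)"
    by (intro tendsto_intros)
  moreover have "\<forall>\<^sub>F s in at_right 0. 0 \<le> A + s * B"
    using eventually_at_right_less[of 0] eventually_at_right[of 0 "1::real"] assms
    by (auto simp: eventually_at_right intro!: exI[of _ 1])
  ultimately show ?thesis
    using tendsto_lowerbound[of "\<lambda>s. A + s * B" "A + 0 * B" "at_right 0" 0] by simp
qed

lemma convex_above_tangent:
  fixes f :: "'a::real_inner \<Rightarrow> real"
  assumes conv: "convex_on UNIV f" and grad: "\<And>z. GDERIV f z :> df z"
    and lip: "L-lipschitz_on UNIV df"
  shows "f y + df y \<bullet> (x - y) \<le> f x"
proof -
  have "0 \<le> (f x - f y - df y \<bullet> (x - y)) + s * (L / 2 * (norm (x - y))\<^sup>2)"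
    if s: "0 < s" "s \<le> 1" for s
  proof -
    have g': "GDERIV (\<lambda>z. - f z) z :> - df z" for z
      by (rule GDERIV_minus[OF grad])
    have l': "L-lipschitz_on UNIV (\<lambda>z. - df z)"
      using lip by simp
    have *: "y + s *\<^sub>R (x - y) = (1 - s) *\<^sub>R y + s *\<^sub>R x"
      by (simp add: algebra_simps)
    \<comment> \<open>The descent lemma for \<open>- f\<close> bounds \<open>f\<close> from below by
      its tangent up to an error of order \<open>s\<^sup>2\<close>; convexity bounds the same value
      from above by the chord.\<close>
    have "f y + s * (df y \<bullet> (x - y)) \<le> f (y + s *\<^sub>R (x - y)) + L / 2 * (s\<^sup>2 * (norm (x - y))\<^sup>2)"
      using descent_lemma[OF g' l', of "y + s *\<^sub>R (x - y)" y] by (simp add: power_mult_distrib)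
    also have "f (y + s *\<^sub>R (x - y)) \<le> (1 - s) * f y + s * f x"
      unfolding * using convex_onD[OF conv, of s y x] s by simp
    finally have "0 \<le> s * ((f x - f y - df y \<bullet> (x - y)) + s * (L / 2 * (norm (x - y))\<^sup>2))"
      by (simp add: algebra_simps power2_eq_square)
    then show ?thesis using s by (simp add: zero_le_mult_iff)
  qed
  from affine_nonneg_at_0[OF this] show ?thesis by simp
qed

section \<open>Lower semicontinuity and proximal points\<close>

lemma lsc_fun_le_limit:
  fixes g :: "'a::topological_space \<Rightarrow> ereal"
  assumes "lsc_fun g" and u: "u \<longlonglongrightarrow> l" and h: "h \<longlonglongrightarrow> c"
    and le: "\<forall>\<^sub>F n in sequentially. g (u n) \<le> ereal (h n)"
  shows "g l \<le> ereal c"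
proof (rule ccontr)
  assume "\<not> g l \<le> ereal c"
  then obtain b where b: "ereal c < ereal b" "ereal b < g l"
    using ereal_dense2[of "ereal c" "g l"] by (meson not_le)
  have "ereal b < Liminf (nhds l) g"
    using assms(1) b(2) unfolding lsc_fun_def by (meson less_le_trans)
  then have "\<forall>\<^sub>F z in nhds l. ereal b < g z"
    by (rule less_LiminfD)
  then have 1: "\<forall>\<^sub>F n in sequentially. ereal b < g (u n)"
    using u by (rule eventually_compose_filterlim)
  have 2: "\<forall>\<^sub>F n in sequentially. h n < b"
    using h b(1) by (simp add: order_tendstoD(2))
  have "\<forall>\<^sub>F n::nat in sequentially. False"
    using 1 2 le by eventually_elim (metis ereal_less_eq(3) leD less_le_trans less_ereal.simps(1) not_less order.strict_implies_order)
  then show False by simp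
qed

lemma convex_funD_real:
  assumes "convex_fun g" "proper_fun g" "g x \<noteq> \<infinity>" "g y \<noteq> \<infinity>" "0 \<le> s" "s \<le> 1"
  shows "g ((1 - s) *\<^sub>R x + s *\<^sub>R y)
    \<le> ereal ((1 - s) * real_of_ereal (g x) + s * real_of_ereal (g y))"
proof -
  obtain p q where "g x = ereal p" "g y = ereal q"
    using assms(2-4) unfolding proper_fun_def by (metis ereal_cases)
  moreover have "g ((1 - s) *\<^sub>R x + s *\<^sub>R y) \<le> ereal (1 - s) * g x + ereal s * g y"
    using assms(1,5,6) unfolding convex_fun_def by simp
  ultimately show ?thesis by simp
qed

text \<open>The quadratic term makes the objective strongly convex, so minimizing sequences are
  Cauchy; lower semicontinuity shows that their limit is a minimizer. The affine minorant keeps the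
  infimum finite.\<close>

lemma prox_is_arg_min:
  fixes g :: "'a::{real_inner, complete_space} \<Rightarrow> ereal"
  assumes proper: "proper_fun g" and lsc: "lsc_fun g" and conv: "convex_fun g"
    and aff: "\<And>x. ereal (b + v \<bullet> x) \<le> g x" and lam: "lam > 0"
  shows "is_arg_min (\<lambda>x. g x + ereal (1 / (2 * lam) * (norm (x - z))\<^sup>2)) (\<lambda>_. True) (prox g lam z)"
proof -
  define D where "D = {x. g x \<noteq> \<infinity>}"
  define gr where "gr x = real_of_ereal (g x)" for x
  define q where "q x = 1 / (2 * lam) * (norm (x - z))\<^sup>2" for x
  define G where "G x = gr x + q x" for x
  define m where "m = Inf (G ` D)"
  have gD: "g x = ereal (gr x)" if "x \<in> D" for x
    using that proper unfolding proper_fun_def D_def gr_def by (cases "g x") auto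
  have Dne: "D \<noteq> {}" using proper unfolding proper_fun_def D_def by auto
  \<comment> \<open>Completing the square: the quadratic dominates the linear part of the
    minorant.\<close>
  have lower: "b + v \<bullet> z - lam / 2 * (norm v)\<^sup>2 \<le> G x" if "x \<in> D" for x
  proof -
    have "(norm (x - z + lam *\<^sub>R v))\<^sup>2
        = (norm (x - z))\<^sup>2 + 2 * lam * (v \<bullet> (x - z)) + lam * (lam * (norm v)\<^sup>2)"
      unfolding power2_norm_eq_inner by (simp add: inner_simps algebra_simps inner_commute)
    also have "(norm (x - z))\<^sup>2 = 2 * lam * q x" unfolding q_def using lam by simp
    finally have "0 \<le> 2 * lam * (q x + v \<bullet> (x - z) + lam / 2 * (norm v)\<^sup>2)"
      using zero_le_power2[of "norm (x - z + lam *\<^sub>R v)"] by (simp add: distrib_left mult.assoc)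
    then have "0 \<le> q x + v \<bullet> (x - z) + lam / 2 * (norm v)\<^sup>2"
      using lam by (simp add: zero_le_mult_iff)
    moreover have "b + v \<bullet> x \<le> gr x" using aff[of x] gD[OF that] by simp
    ultimately show ?thesis unfolding G_def by (simp add: inner_diff_right)
  qed
  have bdd: "bdd_below (G ` D)" using lower by (rule bdd_belowI2)
  have m_le: "m \<le> G x" if "x \<in> D" for x
    unfolding m_def using that bdd by (intro cInf_lower) auto
  \<comment> \<open>The midpoint has value at least \<open>m\<close>, while by the parallelogram
    identity it gains \<open>(norm (x - y))\<^sup>2 / (8 * lam)\<close> over the average.\<close>
  have close: "(norm (x - y))\<^sup>2 \<le> 4 * lam * (G x + G y - 2 * m)" if "x \<in> D" "y \<in> D" for x y
  proof -
    let ?w = "(1 - 1/2) *\<^sub>R x + (1/2) *\<^sub>R y"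
    have gw: "g ?w \<le> ereal ((1 - 1/2) * gr x + (1/2) * gr y)"
      using convex_funD_real[OF conv proper, of x y "1/2"] that unfolding gr_def D_def by simp
    then have wD: "?w \<in> D" unfolding D_def by auto
    have "gr ?w \<le> (gr x + gr y) / 2" using gw gD[OF wD] by simp
    moreover have "q ?w = (q x + q y) / 2 - (norm (x - y))\<^sup>2 / (8 * lam)"
      unfolding q_def power2_norm_eq_inner using lam
      by (simp add: inner_simps field_simps inner_commute)
    ultimately have "G ?w \<le> (G x + G y) / 2 - (norm (x - y))\<^sup>2 / (8 * lam)"
      unfolding G_def by (simp add: add_divide_distrib)
    with m_le[OF wD] have "(norm (x - y))\<^sup>2 / (8 * lam) \<le> (G x + G y) / 2 - m" by simp
    then show ?thesis using lam by (simp add: field_simps)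
  qed
  have "\<exists>x\<in>D. G x < m + inverse (real (Suc n))" for n
    using cInf_lessD[of "G ` D" "m + inverse (real (Suc n))"] Dne unfolding m_def by auto
  then obtain u where u: "\<And>n. u n \<in> D" "\<And>n. G (u n) < m + inverse (real (Suc n))"
    by metis
  have "Cauchy u"
  proof (rule CauchyI)
    fix e :: real assume "0 < e"
    then have "0 < e\<^sup>2 / (8 * lam)" using lam by simp
    then obtain N where N: "inverse (real (Suc N)) < e\<^sup>2 / (8 * lam)"
      using reals_Archimedean by blast
    show "\<exists>M. \<forall>i\<ge>M. \<forall>j\<ge>M. norm (u i - u j) < e"
    proof (intro exI allI impI)
      fix i j assume "N \<le> i" "N \<le> j"
      then have "inverse (real (Suc i)) \<le> inverse (real (Suc N))"
        "inverse (real (Suc j)) \<le> inverse (real (Suc N))"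
        by (auto intro!: le_imp_inverse_le)
      then have "G (u i) + G (u j) - 2 * m < 2 * (e\<^sup>2 / (8 * lam))"
        using u(2)[of i] u(2)[of j] N by linarith
      then have "4 * lam * (G (u i) + G (u j) - 2 * m) < e\<^sup>2"
        using lam by (simp add: field_simps)
      then have "(norm (u i - u j))\<^sup>2 < e\<^sup>2"
        using close[OF u(1)[of i] u(1)[of j]] by linarith
      then show "norm (u i - u j) < e" using \<open>0 < e\<close> by (simp add: power2_less_imp_less)
    qed
  qed
  then obtain l where l: "u \<longlonglongrightarrow> l" using Cauchy_convergent convergent_def by blast
  have "g l \<le> ereal (m + 0 - q l)"
  proof (rule lsc_fun_le_limit[OF lsc l])
    show "(\<lambda>n. m + inverse (real (Suc n)) - q (u n)) \<longlonglongrightarrow> m + 0 - q l"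
      unfolding q_def by (intro tendsto_intros l LIMSEQ_inverse_real_of_nat)
    show "\<forall>\<^sub>F n in sequentially. g (u n) \<le> ereal (m + inverse (real (Suc n)) - q (u n))"
      using u gD unfolding G_def by (auto intro!: always_eventually simp: less_imp_le algebra_simps)
  qed
  then have l_le: "g l + ereal (q l) \<le> ereal m"
    by (cases "g l") auto
  have "ereal m \<le> g x + ereal (q x)" for x
    using m_le[of x] gD[of x] unfolding G_def by (cases "x \<in> D") (auto simp: D_def)
  then have "is_arg_min (\<lambda>x. g x + ereal (q x)) (\<lambda>_. True) l"
    unfolding is_arg_min_linorder using l_le by (meson order_trans)
  \<comment> \<open>\<open>prox\<close> is a choice operator, so the existence of one minimizer is
    enough for the chosen value to be one.\<close>
  then show ?thesis unfolding prox_def arg_min_def q_def by (rule someI)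
qed

text \<open>The second claim says that \<open>(z - p) / lam\<close> is a subgradient of
  \<open>g\<close> at \<open>p\<close>. It follows by comparing \<open>p\<close> with the points
  \<open>(1 - s) *\<^sub>R p + s *\<^sub>R x\<close>, whose quadratic error is of order
  \<open>s\<^sup>2\<close>.\<close>

lemma prox_variational:
  fixes g :: "'a::{real_inner, complete_space} \<Rightarrow> ereal" and z :: 'a
  assumes proper: "proper_fun g" and lsc: "lsc_fun g" and conv: "convex_fun g"
    and aff: "\<And>x. ereal (b + v \<bullet> x) \<le> g x" and lam: "lam > 0"
  defines "p \<equiv> prox g lam z"
  shows "g p \<noteq> \<infinity>"
    and "g x \<noteq> \<infinity> \<Longrightarrow>
      real_of_ereal (g p) + (z - p) \<bullet> (x - p) / lam \<le> real_of_ereal (g x)"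
proof -
  define gr where "gr x = real_of_ereal (g x)" for x
  define q where "q x = 1 / (2 * lam) * (norm (x - z))\<^sup>2" for x
  have min: "g p + ereal (q p) \<le> g x + ereal (q x)" for x
    using prox_is_arg_min[OF proper lsc conv aff lam, of z]
    unfolding is_arg_min_linorder p_def q_def by simp
  have g: "g x = ereal (gr x)" if "g x \<noteq> \<infinity>" for x
    using that proper unfolding proper_fun_def gr_def by (cases "g x") auto
  obtain x0 where "g x0 \<noteq> \<infinity>" using proper unfolding proper_fun_def by auto
  with min[of x0] show p: "g p \<noteq> \<infinity>" using g[of x0] by auto
  assume x: "g x \<noteq> \<infinity>"
  have "0 \<le> (gr x - gr p - (z - p) \<bullet> (x - p) / lam) + s * ((norm (x - p))\<^sup>2 / (2 * lam))"
    if s: "0 < s" "s \<le> 1" for s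
  proof -
    let ?w = "(1 - s) *\<^sub>R p + s *\<^sub>R x"
    have gw: "g ?w \<le> ereal ((1 - s) * gr p + s * gr x)"
      using convex_funD_real[OF conv proper p x] s unfolding gr_def by simp
    then have w: "g ?w \<noteq> \<infinity>" by auto
    have "gr p + q p \<le> gr ?w + q ?w" using min[of ?w] g[OF p] g[OF w] by simp
    moreover have "gr ?w \<le> (1 - s) * gr p + s * gr x" using gw g[OF w] by simp
    moreover have "q ?w = q p - s * ((z - p) \<bullet> (x - p) / lam) + s * (s * ((norm (x - p))\<^sup>2 / (2 * lam)))"
      unfolding q_def power2_norm_eq_inner using lam
      by (simp add: inner_simps field_simps inner_commute)
    ultimately have "0 \<le> s * ((gr x - gr p - (z - p) \<bullet> (x - p) / lam) + s * ((norm (x - p))\<^sup>2 / (2 * lam)))"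
      by (simp add: algebra_simps)
    then show ?thesis using s by (simp add: zero_le_mult_iff)
  qed
  from affine_nonneg_at_0[OF this]
  show "real_of_ereal (g p) + (z - p) \<bullet> (x - p) / lam \<le> real_of_ereal (g x)"
    by (simp add: gr_def)
qed

section \<open>The composite objective and the forward-backward step\<close>

locale composite_problem =
  fixes f :: "'a::{real_inner, complete_space} \<Rightarrow> real"
    and df :: "'a \<Rightarrow> 'a"
    and g :: "'a \<Rightarrow> ereal"
    and L :: real
    and xstar :: 'a
  assumes convex_f: "convex_on UNIV f"
    and grad: "\<And>z. GDERIV f z :> df z"
    and L_pos: "L > 0"
    and lip: "L-lipschitz_on UNIV df"
    and proper: "proper_fun g" and lsc: "lsc_fun g" and convex_g: "convex_fun g"
    and xstar: "xstar \<in> minimizers (objective f g)"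
begin

text \<open>Since \<open>real_of_ereal\<close> sends infinity to 0, \<open>gr\<close> and
  \<open>F\<close> have their intended values only where \<open>g\<close> is finite; hence the
  recurring condition \<open>g x \<noteq> \<infinity>\<close>.\<close>

abbreviation gr :: "'a \<Rightarrow> real" where "gr x \<equiv> real_of_ereal (g x)"

abbreviation F :: "'a \<Rightarrow> real" where "F x \<equiv> f x + gr x"

abbreviation T :: "real \<Rightarrow> 'a \<Rightarrow> 'a" where "T \<equiv> fb_step df g"

abbreviation X :: "'a set" where "X \<equiv> minimizers (objective f g)"

lemma g_eq: "g x \<noteq> \<infinity> \<Longrightarrow> g x = ereal (gr x)"
  using proper unfolding proper_fun_def by (cases "g x") auto

lemma objective_eq: "g x \<noteq> \<infinity> \<Longrightarrow> objective f g x = ereal (F x)"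
  unfolding objective_def by (metis g_eq plus_ereal.simps(1))

lemma objective_xstar_le: "objective f g xstar \<le> objective f g x"
  using xstar unfolding minimizers_def is_arg_min_linorder by simp

lemma g_xstar: "g xstar \<noteq> \<infinity>"
proof -
  obtain x where "g x \<noteq> \<infinity>" using proper unfolding proper_fun_def by auto
  then show ?thesis
    using objective_xstar_le[of x] objective_eq[of x] by (auto simp: objective_def)
qed

lemma F_xstar_le: "g x \<noteq> \<infinity> \<Longrightarrow> F xstar \<le> F x"
  using objective_xstar_le[of x] objective_eq[of x] objective_eq[OF g_xstar] by simp

lemma minimizers_iff: "x \<in> X \<longleftrightarrow> g x \<noteq> \<infinity> \<and> F x = F xstar"
proof
  assume x: "x \<in> X"
  then have "objective f g x \<le> objective f g xstar"
    unfolding minimizers_def is_arg_min_linorder by simp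
  with objective_xstar_le have eq: "objective f g x = objective f g xstar" by (simp add: antisym)
  then have "g x \<noteq> \<infinity>" using objective_eq[OF g_xstar] by (auto simp: objective_def)
  with eq show "g x \<noteq> \<infinity> \<and> F x = F xstar"
    using objective_eq[of x] objective_eq[OF g_xstar] by simp
next
  assume "g x \<noteq> \<infinity> \<and> F x = F xstar"
  then have "objective f g x = objective f g xstar"
    using objective_eq[of x] objective_eq[OF g_xstar] by simp
  then show "x \<in> X"
    unfolding minimizers_def is_arg_min_linorder using objective_xstar_le by simp
qed

text \<open>Optimality of \<^term>\<open>xstar\<close> makes \<open>- df xstar\<close> a subgradient of \<^term>\<open>g\<close>, which yields
  the affine minorant needed for the existence of proximal points without a separation theorem.\<close>

lemma g_affine_minorant: "ereal ((gr xstar + df xstar \<bullet> xstar) + (- df xstar) \<bullet> x) \<le> g x"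
proof (cases "g x = \<infinity>")
  case False
  define D where "D = df xstar \<bullet> (x - xstar)"
  define Q where "Q = L / 2 * (norm (x - xstar))\<^sup>2"
  \<comment> \<open>\<open>xstar\<close> is compared with points of the segment towards
    \<open>x\<close>: convexity controls \<open>g\<close> there and the descent lemma controls
    \<open>f\<close>.\<close>
  have "0 \<le> (gr x - gr xstar + D) + s * Q" if s: "0 < s" "s \<le> 1" for s
  proof -
    define w where "w = (1 - s) *\<^sub>R xstar + s *\<^sub>R x"
    have w_eq: "w - xstar = s *\<^sub>R (x - xstar)" by (simp add: w_def algebra_simps)
    have gw: "g w \<le> ereal ((1 - s) * gr xstar + s * gr x)"
      unfolding w_def using convex_funD_real[OF convex_g proper g_xstar False] s by simp
    then have w: "g w \<noteq> \<infinity>" by auto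
    have "gr w \<le> (1 - s) * gr xstar + s * gr x"
      using gw g_eq[OF w] by (metis ereal_less_eq(3))
    moreover have "F xstar \<le> F w" using F_xstar_le[OF w] .
    moreover have "f w \<le> f xstar + s * D + s * (s * Q)"
      using descent_lemma[OF grad lip, of w xstar] unfolding w_eq D_def Q_def
      by (simp add: power_mult_distrib power2_eq_square mult.left_commute)
    ultimately have "0 \<le> s * ((gr x - gr xstar + D) + s * Q)"
      by (simp add: algebra_simps)
    then show ?thesis using s by (simp add: zero_le_mult_iff)
  qed
  from affine_nonneg_at_0[OF this] show ?thesis
    by (subst g_eq[OF False]) (simp add: D_def inner_simps)
qed simp

lemma g_fb_step: "lam > 0 \<Longrightarrow> g (T lam u) \<noteq> \<infinity>"
  unfolding fb_step_def by (rule prox_variational(1)[OF proper lsc convex_g g_affine_minorant])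

lemma fb_step_variational:
  assumes "lam > 0" "g x \<noteq> \<infinity>"
  shows "gr (T lam u) + ((u - T lam u) \<bullet> (x - T lam u) / lam - df u \<bullet> (x - T lam u)) \<le> gr x"
proof -
  have "(u - lam *\<^sub>R df u - T lam u) \<bullet> (x - T lam u) / lam
      = (u - T lam u) \<bullet> (x - T lam u) / lam - df u \<bullet> (x - T lam u)"
    using assms(1) by (simp add: inner_diff_left diff_divide_distrib)
  then show ?thesis
    using prox_variational(2)[OF proper lsc convex_g g_affine_minorant assms, of "u - lam *\<^sub>R df u"]
    unfolding fb_step_def by simp
qed

text \<open>Testing the variational inequality of each image at the other one and adding gives
  \<open>d \<bullet> d \<le> e \<bullet> d\<close>, so the proximal map is nonexpansive; the
  gradient step contributes the factor \<open>1 + lam * L\<close>. This later bounds the residual at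
  \<open>T lam u\<close> by the residual at \<open>u\<close>.\<close>

lemma fb_step_lipschitz:
  assumes lam: "lam > 0"
  shows "norm (T lam u - T lam w) \<le> (1 + lam * L) * norm (u - w)"
proof -
  define d where "d = T lam u - T lam w"
  define e where "e = (u - w) - lam *\<^sub>R (df u - df w)"
  have "(u - T lam u) \<bullet> (T lam w - T lam u) / lam - df u \<bullet> (T lam w - T lam u)
      + ((w - T lam w) \<bullet> (T lam u - T lam w) / lam - df w \<bullet> (T lam u - T lam w)) \<le> 0"
    using fb_step_variational[OF lam g_fb_step[OF lam, of w], of u]
      fb_step_variational[OF lam g_fb_step[OF lam, of u], of w] by linarith
  also have "(u - T lam u) \<bullet> (T lam w - T lam u) / lam - df u \<bullet> (T lam w - T lam u)
      + ((w - T lam w) \<bullet> (T lam u - T lam w) / lam - df w \<bullet> (T lam u - T lam w))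
      = (d \<bullet> d - e \<bullet> d) / lam"
    unfolding d_def e_def using lam by (simp add: inner_simps field_simps)
  finally have "d \<bullet> d \<le> e \<bullet> d" using lam by (simp add: divide_le_0_iff)
  then have "norm d * norm d \<le> norm e * norm d"
    using norm_cauchy_schwarz[of e d] by (simp add: dot_square_norm power2_eq_square)
  then have "norm d \<le> norm e"
    by (cases "norm d = 0") auto
  also have "\<dots> \<le> norm (u - w) + lam * norm (df u - df w)"
    unfolding e_def using norm_triangle_ineq4[of "u - w" "lam *\<^sub>R (df u - df w)"] lam by simp
  also have "norm (df u - df w) \<le> L * norm (u - w)"
    using lipschitz_onD[OF lip, of u w] by (simp add: dist_norm)
  finally show ?thesis using lam by (simp add: d_def algebra_simps)
qed

text \<open>This transfers the error bound, stated for step size \<open>1 / L\<close>, to the shorter step of the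
  algorithm.\<close>

lemma fb_residual_antimono:
  assumes lam: "0 < lam" "lam \<le> lam'"
  shows "norm (T lam' u - u) / lam' \<le> norm (T lam u - u) / lam"
proof -
  define p q where "p = (1 / lam) *\<^sub>R (u - T lam u)" and "q = (1 / lam') *\<^sub>R (u - T lam' u)"
  have lam': "0 < lam'" using lam by simp
  have Tp: "T lam u = u - lam *\<^sub>R p" and Tq: "T lam' u = u - lam' *\<^sub>R q"
    using lam lam' by (simp_all add: p_def q_def)
  \<comment> \<open>Adding the two inequalities, each tested at the other point, removes the values
    of \<open>g\<close>; the gradient terms cancel because both steps start at
    \<open>u\<close>.\<close>
  have "(u - T lam u) \<bullet> (T lam' u - T lam u) / lam - df u \<bullet> (T lam' u - T lam u)
      + ((u - T lam' u) \<bullet> (T lam u - T lam' u) / lam' - df u \<bullet> (T lam u - T lam' u)) \<le> 0"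
    using fb_step_variational[OF lam(1) g_fb_step[OF lam', of u], of u]
      fb_step_variational[OF lam' g_fb_step[OF lam(1), of u], of u] by linarith
  also have "(u - T lam u) \<bullet> (T lam' u - T lam u) / lam - df u \<bullet> (T lam' u - T lam u)
      + ((u - T lam' u) \<bullet> (T lam u - T lam' u) / lam' - df u \<bullet> (T lam u - T lam' u))
      = lam * (p \<bullet> p) + lam' * (q \<bullet> q) - (lam + lam') * (p \<bullet> q)"
    unfolding Tp Tq using lam(1) lam' by (simp add: inner_simps inner_commute algebra_simps diff_divide_distrib)
  finally have "lam * (norm p)\<^sup>2 + lam' * (norm q)\<^sup>2 \<le> (lam + lam') * (p \<bullet> q)"
    by (simp add: power2_norm_eq_inner)
  also have "\<dots> \<le> (lam + lam') * (norm p * norm q)"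
    using lam lam' by (intro mult_left_mono norm_cauchy_schwarz) auto
  \<comment> \<open>If \<open>norm p < norm q\<close>, then both factors are negative because
    \<open>lam \<le> lam'\<close>.\<close>
  finally have *: "(norm p - norm q) * (lam * norm p - lam' * norm q) \<le> 0"
    by (simp add: algebra_simps power2_eq_square)
  have "norm q \<le> norm p"
  proof (rule ccontr)
    assume "\<not> norm q \<le> norm p"
    then have "norm p < norm q" by simp
    moreover have "lam * norm p \<le> lam' * norm p" using lam(2) by (intro mult_right_mono) auto
    moreover have "lam' * norm p < lam' * norm q" using \<open>norm p < norm q\<close> lam' by simp
    ultimately have "(norm p - norm q) * (lam * norm p - lam' * norm q) > 0"
      by (intro mult_neg_neg) auto
    with * show False by simp
  qed
  then show ?thesis using lam(1) lam' by (simp add: p_def q_def norm_minus_commute)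
qed

text \<open>Sum of the tangent bound for \<open>f\<close>, the descent lemma and the subgradient
  inequality for \<open>g\<close>, with the inner product expanded into squares. It is used with
  \<open>x\<close> a minimizer and with \<open>x\<close> the previous iterate.\<close>

lemma fb_step_decrease:
  assumes lam: "lam > 0" and x: "g x \<noteq> \<infinity>"
  shows "F (T lam u) + (norm (T lam u - x))\<^sup>2 / (2 * lam)
      + (1 - lam * L) / (2 * lam) * (norm (T lam u - u))\<^sup>2
    \<le> F x + (norm (x - u))\<^sup>2 / (2 * lam)"
proof -
  define p where "p = T lam u"
  have "f u + df u \<bullet> (x - u) \<le> f x"
    by (rule convex_above_tangent[OF convex_f grad lip])
  moreover have "f p \<le> f u + df u \<bullet> (p - u) + L / 2 * (norm (p - u))\<^sup>2"
    by (rule descent_lemma[OF grad lip])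
  moreover have "gr p + ((u - p) \<bullet> (x - p) / lam - df u \<bullet> (x - p)) \<le> gr x"
    unfolding p_def by (rule fb_step_variational[OF lam x])
  ultimately have "F p + (u - p) \<bullet> (x - p) / lam - L / 2 * (norm (p - u))\<^sup>2 \<le> F x"
    by (simp add: inner_diff_right)
  moreover have "(u - p) \<bullet> (x - p) / lam = (norm (p - x))\<^sup>2 / (2 * lam)
      + (norm (p - u))\<^sup>2 / (2 * lam) - (norm (x - u))\<^sup>2 / (2 * lam)"
    unfolding power2_norm_eq_inner using lam by (simp add: inner_simps field_simps inner_commute)
  moreover have "(1 - lam * L) / (2 * lam) * (norm (p - u))\<^sup>2
      = (norm (p - u))\<^sup>2 / (2 * lam) - L / 2 * (norm (p - u))\<^sup>2"
    using lam by (simp add: field_simps)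
  ultimately show ?thesis unfolding p_def by linarith
qed

lemma F_gap_le_infdist:
  assumes lam: "lam > 0" "lam * L \<le> 1"
  defines "p u \<equiv> T lam u"
  shows "F (p u) - F xstar
    \<le> norm (p u - u) * (norm (p u - u) + 2 * infdist (p u) X) / (2 * lam)"
proof -
  define n where "n = norm (p u - u)"
  define G where "G = 2 * lam * (F (p u) - F xstar)"
  have *: "G \<le> n * n + n * (2 * dist (p u) z)" if z: "z \<in> X" for z
  proof -
    have gz: "g z \<noteq> \<infinity>" and Fz: "F z = F xstar" using z minimizers_iff by auto
    have "0 \<le> (1 - lam * L) / (2 * lam) * (norm (p u - u))\<^sup>2" using lam by simp
    then have "F (p u) + (norm (p u - z))\<^sup>2 / (2 * lam) \<le> F xstar + (norm (z - u))\<^sup>2 / (2 * lam)"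
      using fb_step_decrease[OF lam(1) gz, of u] Fz unfolding p_def by linarith
    then have "F (p u) - F xstar \<le> ((norm (z - u))\<^sup>2 - (norm (p u - z))\<^sup>2) / (2 * lam)"
      by (simp add: diff_divide_distrib)
    then have "G \<le> (norm (z - u))\<^sup>2 - (norm (p u - z))\<^sup>2"
      unfolding G_def using lam(1) by (simp add: pos_le_divide_eq mult.commute)
    moreover have "norm (z - u) \<le> n + dist (p u) z"
      using dist_triangle[of z u "p u"] by (simp add: n_def dist_norm norm_minus_commute)
    then have "(norm (z - u))\<^sup>2 \<le> (n + dist (p u) z)\<^sup>2" by (intro power_mono) auto
    ultimately show ?thesis by (simp add: dist_norm power2_eq_square algebra_simps)
  qed
  have "G \<le> n * n + n * (2 * infdist (p u) X)"
  \<comment> \<open>No nearest minimizer is selected: for \<open>n > 0\<close> the bound is solved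
    for the distance and passed to the infimum, and for \<open>n = 0\<close> the distance term
    vanishes.\<close>
  proof (cases "n = 0")
    case True
    then show ?thesis using *[OF xstar] by simp
  next
    case False
    then have n: "n > 0" by (simp add: n_def)
    have "(G / n - n) / 2 \<le> dist (p u) z" if "z \<in> X" for z
      using *[OF that] n by (simp add: field_simps)
    then have "(G / n - n) / 2 \<le> infdist (p u) X"
      using xstar by (subst infdist_notempty) (blast, rule cINF_greatest, blast+)
    then show ?thesis using n by (simp add: field_simps)
  qed
  then have "G \<le> n * (n + 2 * infdist (p u) X)" by (simp add: algebra_simps)
  then show ?thesis unfolding G_def n_def[symmetric] using lam(1)
    by (simp add: pos_le_divide_eq mult.commute mult.left_commute)
qed

text \<open>The error bound is applied at the image \<open>T lam u\<close>, whose residual is first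
  reduced to that of \<open>u\<close>; with it the distance in \<open>F_gap_le_infdist\<close>
  becomes a multiple of the residual.\<close>

lemma F_gap_le_residual:
  assumes eb: "local_error_bound f df g L" and lam: "lam > 0" "lam * L \<le> 1"
  obtains \<epsilon> C where "\<epsilon> > 0" "C > 0"
    "\<And>u. norm (T lam u - u) < \<epsilon> \<Longrightarrow> F (T lam u) \<le> \<xi> \<Longrightarrow>
      F (T lam u) - F xstar \<le> C * (norm (T lam u - u))\<^sup>2"
proof -
  have Inf_eq: "Inf (range (objective f g)) = ereal (F xstar)"
    using objective_xstar_le objective_eq[OF g_xstar]
    by (metis (mono_tags, lifting) INF_greatest INF_lower UNIV_I antisym)
  \<comment> \<open>The maximum with \<open>F xstar\<close> makes the level admissible for the error
    bound whatever \<open>\<xi>\<close> is.\<close>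
  obtain \<epsilon>0 \<tau> where eb0: "\<epsilon>0 > 0" "\<tau> > 0" and
    EB: "\<And>x. norm (T (1 / L) x - x) < \<epsilon>0 \<Longrightarrow> objective f g x \<le> ereal (max \<xi> (F xstar))
      \<Longrightarrow> infdist x X \<le> \<tau> * norm (T (1 / L) x - x)"
    using eb[unfolded local_error_bound_def Let_def Inf_eq, rule_format, of "max \<xi> (F xstar)"]
    by (metis ereal_less_eq(3) max.cobounded2)
  \<comment> \<open>The factor \<open>1 + lam * L\<close> comes from
    \<open>fb_step_lipschitz\<close>, and \<open>1 / (lam * L)\<close> from changing the step from
    \<open>lam\<close> to \<open>1 / L\<close>.\<close>
  define M where "M = (1 + lam * L) / (lam * L)"
  have lL: "0 < lam * L" using lam L_pos by simp
  then have M: "M > 0" unfolding M_def by (simp add: add_pos_pos)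
  show ?thesis
  proof (rule that[of "\<epsilon>0 / M" "(1 + 2 * \<tau> * M) / (2 * lam)"])
    show "0 < \<epsilon>0 / M" "0 < (1 + 2 * \<tau> * M) / (2 * lam)"
      using eb0 M lam by (simp_all add: add_pos_pos)
    fix u
    define p where "p = T lam u"
    define n where "n = norm (p - u)"
    assume "norm (T lam u - u) < \<epsilon>0 / M" and \<xi>: "F (T lam u) \<le> \<xi>"
    then have n: "M * n < \<epsilon>0" using M by (simp add: n_def p_def field_simps)
    have "norm (T (1 / L) p - p) / (1 / L) \<le> norm (T lam p - p) / lam"
      using lam L_pos by (intro fb_residual_antimono) (simp_all add: field_simps)
    also have "norm (T lam p - p) / lam \<le> ((1 + lam * L) * n) / lam"
      using fb_step_lipschitz[OF lam(1), of p u] lam by (simp add: n_def p_def divide_right_mono)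
    finally have res: "norm (T (1 / L) p - p) \<le> M * n"
      unfolding M_def using lam L_pos by (simp add: field_simps)
    have "objective f g p \<le> ereal (max \<xi> (F xstar))"
      using objective_eq[OF g_fb_step[OF lam(1), of u]] \<xi> by (simp add: p_def le_max_iff_disj)
    then have "infdist p X \<le> \<tau> * norm (T (1 / L) p - p)"
      using EB[of p] res n by linarith
    also have "\<dots> \<le> \<tau> * (M * n)" using res eb0 by (intro mult_left_mono) auto
    finally have "n * (n + 2 * infdist p X) / (2 * lam) \<le> n * (n + 2 * (\<tau> * (M * n))) / (2 * lam)"
      using lam by (intro divide_right_mono mult_left_mono) (auto simp: n_def)
    then have "F p - F xstar \<le> n * (n + 2 * (\<tau> * (M * n))) / (2 * lam)"
      using F_gap_le_infdist[OF lam, of u] unfolding n_def p_def by linarith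
    also have "\<dots> = (1 + 2 * \<tau> * M) / (2 * lam) * n\<^sup>2"
      by (simp add: power2_eq_square algebra_simps)
    finally show "F (T lam u) - F xstar \<le> (1 + 2 * \<tau> * M) / (2 * lam) * (norm (T lam u - u))\<^sup>2"
      by (simp add: n_def p_def)
  qed
qed

text \<open>\<open>f\<close> is continuous, so the values of \<open>g\<close> along the sequence
  converge to \<open>F xstar - f l\<close>, and lower semicontinuity of \<open>g\<close> gives
  \<open>F l \<le> F xstar\<close>.\<close>

lemma limit_in_minimizers:
  assumes u: "u \<longlonglongrightarrow> l" and gu: "\<forall>\<^sub>F n in sequentially. g (u n) \<noteq> \<infinity>"
    and F: "(\<lambda>n. F (u n)) \<longlonglongrightarrow> F xstar"
  shows "l \<in> X"
proof -
  have "isCont f l" using grad[of l] unfolding gderiv_def by (rule has_derivative_continuous)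
  then have "(\<lambda>n. f (u n)) \<longlonglongrightarrow> f l" using u by (rule isCont_tendsto_compose)
  from tendsto_diff[OF F this] have "(\<lambda>n. gr (u n)) \<longlonglongrightarrow> F xstar - f l" by simp
  then have le: "g l \<le> ereal (F xstar - f l)"
    by (rule lsc_fun_le_limit[OF lsc u]) (use gu in eventually_elim, simp add: g_eq[symmetric])
  then have gl: "g l \<noteq> \<infinity>" by auto
  have "gr l \<le> F xstar - f l" using le by (subst (asm) g_eq[OF gl]) simp
  then have "F l = F xstar" using F_xstar_le[OF gl] by simp
  with gl show ?thesis using minimizers_iff by simp
qed

end

section \<open>Energy estimates for the inertial iteration\<close>

lemma telescoping_dominated:
  fixes A B :: "nat \<Rightarrow> real"
  assumes step: "\<And>k. N \<le> k \<Longrightarrow> A (Suc k) + B k \<le> A k"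
    and A: "\<And>k. N \<le> k \<Longrightarrow> 0 \<le> A k" and B: "\<And>k. N \<le> k \<Longrightarrow> 0 \<le> B k"
  shows "B \<longlonglongrightarrow> 0" and "N \<le> k \<Longrightarrow> A k \<le> A N"
proof -
  define A' where "A' k = A (k + N)" for k
  have dec: "decseq A'"
  proof (intro decseq_SucI)
    show "A' (Suc k) \<le> A' k" for k
      using step[of "k + N"] B[of "k + N"] by (simp add: A'_def)
  qed
  then show "N \<le> k \<Longrightarrow> A k \<le> A N"
    using decseqD[of A' 0 "k - N"] by (simp add: A'_def)
  obtain l where l: "A' \<longlonglongrightarrow> l"
  proof (rule decseq_convergent[OF dec])
    show "\<forall>k. 0 \<le> A' k" using A by (simp add: A'_def)
  qed
  \<comment> \<open>\<open>B\<close> is squeezed between 0 and the differences of a convergent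
    sequence.\<close>
  have "(\<lambda>k. A' k - A' (Suc k)) \<longlonglongrightarrow> l - l"
    using l by (intro tendsto_diff) (auto simp: LIMSEQ_Suc)
  then have lim: "(\<lambda>k. A' k - A' (Suc k)) \<longlonglongrightarrow> 0" by simp
  have ev0: "\<forall>\<^sub>F k in sequentially. 0 \<le> B (k + N)" using B by simp
  have ev: "\<forall>\<^sub>F k in sequentially. B (k + N) \<le> A' k - A' (Suc k)"
  proof (intro always_eventually allI)
    show "B (k + N) \<le> A' k - A' (Suc k)" for k
      using step[of "k + N"] by (simp add: A'_def)
  qed
  have "(\<lambda>k. B (k + N)) \<longlonglongrightarrow> 0"
    by (rule tendsto_sandwich[OF ev0 ev tendsto_const lim])
  then show "B \<longlonglongrightarrow> 0" by (rule LIMSEQ_offset)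
qed

context composite_problem
begin

text \<open>Stated for general \<open>t\<close>: \<open>t1\<close> and \<open>t_step\<close> keep
  \<open>\<gamma> k\<close> between 0 and 1, and \<open>t_ratio\<close> lets the weights
  \<open>(t k)\<^sup>2\<close> grow slowly enough to be absorbed.\<close>

theorem inertial_fb_rates:
  assumes eb: "local_error_bound f df g L"
    and lam: "lam > 0" "lam * L < 1"
    and iter: "inertial_fb df g lam t x y"
    and t1: "\<And>k. k \<ge> 1 \<Longrightarrow> 1 \<le> t k"
    and t_step: "\<And>k. k \<ge> 1 \<Longrightarrow> t k - 1 \<le> t (Suc k)"
    and t_ratio: "(\<lambda>k. t (Suc k) / t k) \<longlonglongrightarrow> 1"
  shows "(\<lambda>k. (t k)\<^sup>2 * (F (x k) - F xstar)) \<longlonglongrightarrow> 0"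
    and "\<exists>C. \<forall>\<^sub>F k in sequentially. t k * norm (x k - x (k - 1)) \<le> C"
proof -
  define \<gamma> where "\<gamma> k = (t k - 1) / t (Suc k)" for k
  define w where "w k = F (x k) - F xstar" for k
  define \<delta> where "\<delta> k = (norm (x k - x (k - 1)))\<^sup>2 / (2 * lam)" for k
  define c where "c = (1 - lam * L) / (2 * lam)"
  define d where "d k = (norm (x k - y k))\<^sup>2" for k
  have c: "c > 0" unfolding c_def using lam by simp
  have xk: "x k = T lam (y k)" and yk: "y (Suc k) = x k + \<gamma> k *\<^sub>R (x k - x (k - 1))" if "k \<ge> 1" for k
    using iter that unfolding inertial_fb_def \<gamma>_def by auto
  have gx: "g (x k) \<noteq> \<infinity>" if "k \<ge> 1" for k
    using g_fb_step[OF lam(1)] xk[OF that] by simp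
  have w0: "0 \<le> w k" if "k \<ge> 1" for k
    unfolding w_def using F_xstar_le[OF gx[OF that]] by simp
  have \<delta>0: "0 \<le> \<delta> k" and d0: "0 \<le> d k" for k unfolding \<delta>_def d_def using lam by simp_all
  have \<gamma>: "0 \<le> \<gamma> k" "\<gamma> k \<le> 1" if "k \<ge> 1" for k
    unfolding \<gamma>_def using t1[OF that] t1[of "Suc k"] t_step[OF that] by (auto simp: divide_le_eq)
  \<comment> \<open>The step from \<open>y (Suc k)\<close> is tested at \<open>x k\<close>; the
    distance between these two is \<open>\<gamma> k\<close> times the last increment.\<close>
  have main: "w (Suc k) + \<delta> (Suc k) + c * d (Suc k) \<le> w k + (\<gamma> k)\<^sup>2 * \<delta> k" if k: "k \<ge> 1" for k
  proof -
    have "(norm (x k - y (Suc k)))\<^sup>2 = (\<gamma> k)\<^sup>2 * (norm (x k - x (k - 1)))\<^sup>2"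
      by (simp add: yk[OF k] power_mult_distrib)
    then show ?thesis
      using fb_step_decrease[OF lam(1) gx[OF k], of "y (Suc k)"] xk[of "Suc k"]
      unfolding w_def \<delta>_def c_def d_def by (simp add: field_simps)
  qed
  \<comment> \<open>This first, unweighted pass provides the small residuals and the bounded level
    that the error bound requires.\<close>
  have energy: "(w (Suc k) + \<delta> (Suc k)) + c * d (Suc k) \<le> w k + \<delta> k" if "1 \<le> k" for k
  proof -
    have "(\<gamma> k)\<^sup>2 * \<delta> k \<le> 1 * \<delta> k"
      using \<gamma>[OF that] \<delta>0 by (intro mult_right_mono) (auto simp: power_le_one)
    then show ?thesis using main[OF that] by simp
  qed
  have wd0: "0 \<le> w k + \<delta> k" "0 \<le> c * d (Suc k)" if "1 \<le> k" for k
    using w0[OF that] \<delta>0[of k] d0 c by auto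
  have "(\<lambda>k. c * d (Suc k)) \<longlonglongrightarrow> 0"
    by (rule telescoping_dominated(1)[of 1 "\<lambda>k. w k + \<delta> k", OF energy wd0])
  then have "(\<lambda>k. inverse c * (c * d (Suc k))) \<longlonglongrightarrow> inverse c * 0"
    by (intro tendsto_intros)
  then have d_lim: "(\<lambda>k. d (Suc k)) \<longlonglongrightarrow> 0" using c by simp
  \<comment> \<open>The level starts at index 1, since \<open>g (x 0)\<close> may be
    infinite.\<close>
  define \<xi> where "\<xi> = w 1 + \<delta> 1 + F xstar"
  have F_le: "F (x k) \<le> \<xi>" if "1 \<le> k" for k
  proof -
    have "w k + \<delta> k \<le> w 1 + \<delta> 1"
      by (rule telescoping_dominated(2)[where A = "\<lambda>k. w k + \<delta> k" and B = "\<lambda>k. c * d (Suc k)"])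
        (use energy wd0 that in blast)+
    then show ?thesis using \<delta>0[of k] unfolding \<xi>_def w_def by simp
  qed
  obtain \<epsilon> C where \<epsilon>: "\<epsilon> > 0" and C: "C > 0" and EB:
    "\<And>u. norm (T lam u - u) < \<epsilon> \<Longrightarrow> F (T lam u) \<le> \<xi> \<Longrightarrow>
      F (T lam u) - F xstar \<le> C * (norm (T lam u - u))\<^sup>2"
    using F_gap_le_residual[OF eb lam(1) less_imp_le[OF lam(2)], of \<xi>] by blast
  define \<kappa> where "\<kappa> = c / C"
  have \<kappa>: "\<kappa> > 0" unfolding \<kappa>_def using c C by simp
  have "\<forall>\<^sub>F k in sequentially. d (Suc k) < \<epsilon>\<^sup>2"
    using d_lim \<epsilon> by (intro order_tendstoD(2)) auto
  \<comment> \<open>Half of the gain \<open>\<kappa>\<close> pays for the growth of the weights; the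
    other half remains as the decrease of \<open>W\<close>.\<close>
  moreover have "\<forall>\<^sub>F k in sequentially. (t (Suc k) / t k)\<^sup>2 < 1 + \<kappa> / 2"
    using tendsto_power[OF t_ratio, of 2] \<kappa> by (intro order_tendstoD(2)) auto
  ultimately have "\<forall>\<^sub>F k in sequentially. d (Suc k) < \<epsilon>\<^sup>2 \<and> (t (Suc k) / t k)\<^sup>2 < 1 + \<kappa> / 2 \<and> 1 \<le> k"
    using eventually_ge_at_top[of 1] by eventually_elim simp
  then obtain N where N: "\<And>k. k \<ge> N \<Longrightarrow> d (Suc k) < \<epsilon>\<^sup>2 \<and> (t (Suc k) / t k)\<^sup>2 < 1 + \<kappa> / 2 \<and> 1 \<le> k"
    by (auto simp: eventually_sequentially)
  define W where "W k = (1 + \<kappa>) * ((t k)\<^sup>2 * w k) + (t k)\<^sup>2 * \<delta> k" for k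
  have W_step: "W (Suc k) + \<kappa> / 2 * ((t k)\<^sup>2 * w k) \<le> W k" if k: "N \<le> k" for k
  proof -
    have k1: "1 \<le> k" using N[OF k] by simp
    have tk: "0 < t k" "0 < t (Suc k)" using t1[OF k1] t1[of "Suc k"] by auto
    have "norm (x (Suc k) - y (Suc k)) < \<epsilon>"
      using N[OF k] \<epsilon> unfolding d_def by (auto intro: power2_less_imp_less)
    then have "w (Suc k) \<le> C * d (Suc k)"
      using EB[of "y (Suc k)"] xk[of "Suc k"] F_le[of "Suc k"] unfolding w_def d_def by simp
    then have "\<kappa> * w (Suc k) \<le> \<kappa> * (C * d (Suc k))" using \<kappa> by (intro mult_left_mono) auto
    then have "\<kappa> * w (Suc k) \<le> c * d (Suc k)" using C by (simp add: \<kappa>_def)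
    then have "(1 + \<kappa>) * w (Suc k) + \<delta> (Suc k) \<le> w k + (\<gamma> k)\<^sup>2 * \<delta> k"
      using main[OF k1] by (simp add: algebra_simps)
    then have "(t (Suc k))\<^sup>2 * ((1 + \<kappa>) * w (Suc k) + \<delta> (Suc k))
        \<le> (t (Suc k))\<^sup>2 * (w k + (\<gamma> k)\<^sup>2 * \<delta> k)"
      by (intro mult_left_mono) auto
    then have "W (Suc k) \<le> (t (Suc k))\<^sup>2 * w k + ((t (Suc k))\<^sup>2 * (\<gamma> k)\<^sup>2) * \<delta> k"
      unfolding W_def by (simp add: algebra_simps)
    \<comment> \<open>The denominator of \<open>\<gamma> k\<close> cancels the new weight, so the
      increment term needs no part of the gain.\<close>
    also have "(t (Suc k))\<^sup>2 * (\<gamma> k)\<^sup>2 = (t k - 1)\<^sup>2"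
      using tk by (simp add: \<gamma>_def power_divide)
    also have "(t k - 1)\<^sup>2 * \<delta> k \<le> (t k)\<^sup>2 * \<delta> k"
      using t1[OF k1] \<delta>0 by (intro mult_right_mono power_mono) auto
    also have "(t (Suc k))\<^sup>2 * w k \<le> ((1 + \<kappa> / 2) * (t k)\<^sup>2) * w k"
      using N[OF k] tk w0[OF k1] by (intro mult_right_mono) (auto simp: power_divide divide_less_eq)
    finally show ?thesis unfolding W_def by (simp add: algebra_simps)
  qed
  have W0: "0 \<le> W k" "0 \<le> \<kappa> / 2 * ((t k)\<^sup>2 * w k)" if "N \<le> k" for k
    unfolding W_def using w0[of k] N[OF that] \<delta>0[of k] \<kappa> by auto
  have "(\<lambda>k. \<kappa> / 2 * ((t k)\<^sup>2 * w k)) \<longlonglongrightarrow> 0"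
    by (rule telescoping_dominated(1)[of N W]) (use W_step W0 in blast)+
  then have "(\<lambda>k. 2 / \<kappa> * (\<kappa> / 2 * ((t k)\<^sup>2 * w k))) \<longlonglongrightarrow> 2 / \<kappa> * 0"
    by (intro tendsto_mult tendsto_const)
  then show "(\<lambda>k. (t k)\<^sup>2 * (F (x k) - F xstar)) \<longlonglongrightarrow> 0" using \<kappa> by (simp add: w_def)
  have W_le: "W k \<le> W N" if "N \<le> k" for k
    by (rule telescoping_dominated(2)[where A = W and B = "\<lambda>k. \<kappa> / 2 * ((t k)\<^sup>2 * w k)"])
      (use W_step W0 that in blast)+
  show "\<exists>C. \<forall>\<^sub>F k in sequentially. t k * norm (x k - x (k - 1)) \<le> C"
  proof (intro exI eventually_sequentiallyI)
    fix k assume k: "N \<le> k"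
    have "0 \<le> (1 + \<kappa>) * ((t k)\<^sup>2 * w k)" using w0[of k] N[OF k] \<kappa> by auto
    then have "(t k)\<^sup>2 * \<delta> k \<le> W N"
      using W_le[OF k] unfolding W_def by linarith
    then have "(t k * norm (x k - x (k - 1)))\<^sup>2 \<le> 2 * lam * W N"
      unfolding \<delta>_def power_mult_distrib using lam by (simp add: field_simps)
    then show "t k * norm (x k - x (k - 1)) \<le> sqrt (2 * lam * W N)"
      by (rule real_le_rsqrt)
  qed
qed

end

section \<open>Convergence from power-law increments\<close>

lemma powr_le_diff:
  fixes r :: real
  assumes r: "r > 1" and k: "k \<ge> 1"
  shows "(r - 1) * (1 / real (Suc k) powr r)
    \<le> 1 / real k powr (r - 1) - 1 / real (Suc k) powr (r - 1)"
proof -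
  have "((\<lambda>z. z powr (1 - r)) has_real_derivative (1 - r) * z powr (1 - r - 1)) (at z)"
    if "real k \<le> z" for z
    using that k by (intro has_real_derivative_powr) auto
  then obtain z where z: "real k < z" "z < real (Suc k)"
    "real (Suc k) powr (1 - r) - real k powr (1 - r)
      = (real (Suc k) - real k) * ((1 - r) * z powr (1 - r - 1))"
    using MVT2[of "real k" "real (Suc k)" "\<lambda>z. z powr (1 - r)" "\<lambda>z. (1 - r) * z powr (1 - r - 1)"]
    by (metis lessI of_nat_less_iff)
  \<comment> \<open>The mean value point lies before \<open>Suc k\<close>, and the derivative of
    \<open>z powr (1 - r)\<close> decreases in size.\<close>
  have "real (Suc k) powr (- r) \<le> z powr (- r)"
    using z k r by (intro powr_mono2') auto
  then have "(r - 1) * real (Suc k) powr (- r) \<le> (r - 1) * z powr (- r)"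
    using r by (intro mult_left_mono) auto
  also have "\<dots> = real k powr (1 - r) - real (Suc k) powr (1 - r)"
    using z(3) by (simp add: algebra_simps)
  finally show ?thesis
    by (simp add: powr_minus_divide[symmetric])
qed

text \<open>\<open>powr_le_diff\<close> dominates the increments by differences of
  \<open>K * \<phi>\<close>, which telescope to a bound independent of the later index. It gives the
  Cauchy property and, in the limit, the rate.\<close>

lemma convergent_of_powr_increments:
  fixes x :: "nat \<Rightarrow> 'a::{real_normed_vector, complete_space}"
  assumes r: "r > 1"
    and O: "(\<lambda>k. norm (x k - x (k - 1))) \<in> O(\<lambda>k. 1 / real k powr r)"
  obtains l where "x \<longlonglongrightarrow> l" "(\<lambda>k. norm (x k - l)) \<in> O(\<lambda>k. 1 / real k powr (r - 1))"
proof -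
  define \<phi> where "\<phi> k = 1 / real k powr (r - 1)" for k
  obtain C where C: "C > 0"
    and "\<forall>\<^sub>F k in sequentially. norm (norm (x k - x (k - 1))) \<le> C * norm (1 / real k powr r)"
    using landau_o.bigE[OF O] by blast
  then obtain N where N: "\<And>k. k \<ge> N \<Longrightarrow> norm (x k - x (k - 1)) \<le> C * (1 / real k powr r)"
    by (auto simp: eventually_sequentially)
  define M where "M = max N 1"
  define K where "K = C / (r - 1)"
  have K: "K > 0" using C r by (simp add: K_def)
  have incr: "norm (x (Suc k) - x k) \<le> K * (\<phi> k - \<phi> (Suc k))" if "k \<ge> M" for k
  proof -
    have "norm (x (Suc k) - x k) \<le> C * (1 / real (Suc k) powr r)"
      using N[of "Suc k"] that by (simp add: M_def)
    also have "\<dots> = K * ((r - 1) * (1 / real (Suc k) powr r))"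
      using r by (simp add: K_def)
    also have "\<dots> \<le> K * (\<phi> k - \<phi> (Suc k))"
      unfolding \<phi>_def using K that by (intro mult_left_mono powr_le_diff r) (auto simp: M_def)
    finally show ?thesis .
  qed
  have tele: "norm (x m - x n) \<le> K * (\<phi> n - \<phi> m)" if "M \<le> n" "n \<le> m" for m n
    using that(2)
  proof (induction m rule: dec_induct)
    case (step m)
    have "norm (x (Suc m) - x n) \<le> norm (x (Suc m) - x m) + norm (x m - x n)"
      using norm_triangle_ineq[of "x (Suc m) - x m" "x m - x n"] by simp
    also have "\<dots> \<le> K * (\<phi> m - \<phi> (Suc m)) + K * (\<phi> n - \<phi> m)"
      using step.IH step.hyps that(1) by (intro add_mono incr) auto
    finally show ?case by (simp add: algebra_simps)
  qed simp
  have bound: "norm (x m - x n) \<le> K * \<phi> n" if "M \<le> n" "n \<le> m" for m n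
  proof -
    have "K * (\<phi> n - \<phi> m) \<le> K * \<phi> n" using K by (intro mult_left_mono) (auto simp: \<phi>_def)
    with tele[OF that] show ?thesis by linarith
  qed
  have \<phi>_lim: "\<phi> \<longlonglongrightarrow> 0"
    unfolding \<phi>_def using r by real_asymp
  have "Cauchy x"
  proof (rule CauchyI')
    fix e :: real assume "0 < e"
    then have "\<forall>\<^sub>F n in sequentially. K * \<phi> n < e"
      using tendsto_mult_left[OF \<phi>_lim, of K] by (intro order_tendstoD(2)) auto
    then obtain n0 where n0: "\<And>n. n \<ge> n0 \<Longrightarrow> K * \<phi> n < e"
      by (auto simp: eventually_sequentially)
    show "\<exists>M. \<forall>m\<ge>M. \<forall>n>m. dist (x m) (x n) < e"
    proof (intro exI allI impI)
      fix m n assume "max M n0 \<le> m" "m < n"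
      then show "dist (x m) (x n) < e"
        using bound[of m n] n0[of m] by (simp add: dist_norm norm_minus_commute)
    qed
  qed
  then obtain l where l: "x \<longlonglongrightarrow> l" using Cauchy_convergent convergent_def by blast
  have "norm (x n - l) \<le> K * \<phi> n" if "M \<le> n" for n
  proof (rule tendsto_upperbound)
    show "(\<lambda>m. norm (x n - x m)) \<longlonglongrightarrow> norm (x n - l)" by (intro tendsto_intros l)
    show "\<forall>\<^sub>F m in sequentially. norm (x n - x m) \<le> K * \<phi> n"
      using eventually_ge_at_top[of n]
      by eventually_elim (use bound[OF that] in \<open>simp add: norm_minus_commute\<close>)
  qed simp
  then have "\<forall>\<^sub>F n in sequentially. norm (norm (x n - l)) \<le> K * norm (\<phi> n)"
    unfolding \<phi>_def eventually_sequentially by (intro exI[of _ M]) simp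
  then have "(\<lambda>k. norm (x k - l)) \<in> O(\<phi>)" by (rule landau_o.bigI[OF K])
  then show ?thesis using that[OF l] by (simp add: \<phi>_def[abs_def])
qed

section \<open>Specialization to polynomial parameters\<close>

theorem corollary3p2:
  fixes f :: "'a::{real_inner, complete_space} \<Rightarrow> real"
    and df :: "'a \<Rightarrow> 'a"
    and g :: "'a \<Rightarrow> ereal"
    and L \<mu> r a :: real
    and x y :: "nat \<Rightarrow> 'a"
    and xstar :: 'a
  assumes "convex_on UNIV f"
    and "\<And>z. GDERIV f z :> df z"
    and "continuous_on UNIV df"
    and "L > 0"
    and "L-lipschitz_on UNIV df"
    and "proper_fun g" and "lsc_fun g" and "convex_fun g"
    and "0 < \<mu>" and "\<mu> < 1"
    and "r > 1" and "a > 0"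
    and "local_error_bound f df g L"
    and "inertial_fb df g (\<mu> / L) (\<lambda>k. (real k powr r - 1 + a) / a) x y"
    and "xstar \<in> minimizers (objective f g)"
  shows "(\<forall>k\<ge>1. \<bar>objective f g (x k)\<bar> \<noteq> \<infinity>) \<and>
      (\<lambda>k. real_of_ereal (objective f g (x k) - objective f g xstar))
         \<in> o(\<lambda>k. 1 / real k powr (2 * r)) \<and>
      (\<lambda>k. norm (x k - x (k - 1))) \<in> O(\<lambda>k. 1 / real k powr r) \<and>
      (\<exists>xbar \<in> minimizers (objective f g).
         x \<longlonglongrightarrow> xbar \<and>
         (\<lambda>k. norm (x k - xbar)) \<in> O(\<lambda>k. 1 / real k powr (r - 1)))"
proof -
  interpret composite_problem f df g L xstar
    by unfold_locales (use assms in auto)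
  note r = \<open>r > 1\<close> and a = \<open>a > 0\<close>
  define t where "t k = (real k powr r - 1 + a) / a" for k
  define lam where "lam = \<mu> / L"
  define w where "w k = F (x k) - F xstar" for k
  have lam: "lam > 0" "lam * L < 1" using assms(4,9,10) by (simp_all add: lam_def)
  have iter: "inertial_fb df g lam t x y" using assms(14) by (simp add: lam_def t_def[abs_def])
  \<comment> \<open>At index 0 this fails, because \<open>0 powr r = 0\<close> gives
    \<open>t 0 = (a - 1) / a\<close>.\<close>
  have t1: "1 \<le> t k" if "k \<ge> 1" for k
    using ge_one_powr_ge_zero[of "real k" r] that r a by (simp add: t_def)
  have t_step: "t k - 1 \<le> t (Suc k)" for k
  proof -
    have "real k powr r \<le> real (Suc k) powr r" using r by (intro powr_mono2) auto
    then have "t k \<le> t (Suc k)" unfolding t_def using a by (intro divide_right_mono) auto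
    then show ?thesis by simp
  qed
  have t_ratio: "(\<lambda>k. t (Suc k) / t k) \<longlonglongrightarrow> 1"
    unfolding t_def using r a by real_asymp
  have t_lim: "(\<lambda>k. real k powr r / t k) \<longlonglongrightarrow> a"
    unfolding t_def using r a by real_asymp
  \<comment> \<open>Any constant above the limit \<open>a\<close> of the ratio would do;
    \<open>2 * a\<close> is one.\<close>
  have t_ev: "\<forall>\<^sub>F k in sequentially. real k powr r \<le> 2 * a * t k"
  proof -
    have "\<forall>\<^sub>F k in sequentially. real k powr r / t k < 2 * a"
      using t_lim a by (intro order_tendstoD(2)) auto
    then show ?thesis
      using eventually_ge_at_top[of 1]
      by eventually_elim (use t1 in \<open>fastforce simp: divide_less_eq\<close>)
  qed
  note rates = inertial_fb_rates[OF assms(13) lam iter t1 t_step t_ratio]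
  have gx: "g (x k) \<noteq> \<infinity>" if "k \<ge> 1" for k
    using iter that g_fb_step[OF lam(1)] unfolding inertial_fb_def by simp
  have obj: "objective f g (x k) = ereal (F (x k))" if "k \<ge> 1" for k
    by (rule objective_eq[OF gx[OF that]])
  have fin: "\<forall>k\<ge>1. \<bar>objective f g (x k)\<bar> \<noteq> \<infinity>" using obj by simp
  have ev_w: "\<forall>\<^sub>F k in sequentially.
      real_of_ereal (objective f g (x k) - objective f g xstar) = w k"
    using eventually_ge_at_top[of 1]
    by eventually_elim (use obj objective_eq[OF g_xstar] in \<open>simp add: w_def\<close>)
  have w_lim: "(\<lambda>k. (t k)\<^sup>2 * w k) \<longlonglongrightarrow> 0" unfolding w_def by (rule rates(1)) auto
  have w_o: "w \<in> o(\<lambda>k. 1 / real k powr (2 * r))"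
  proof (rule smalloI_tendsto)
    \<comment> \<open>The weight \<open>(t k)\<^sup>2\<close> is exchanged for
      \<open>real k powr (2 * r)\<close> at the cost of a convergent factor.\<close>
    have "(\<lambda>k. (real k powr r / t k)\<^sup>2 * ((t k)\<^sup>2 * w k)) \<longlonglongrightarrow> a\<^sup>2 * 0"
      by (intro tendsto_mult w_lim tendsto_power t_lim)
    then have "(\<lambda>k. (real k powr r / t k)\<^sup>2 * ((t k)\<^sup>2 * w k)) \<longlonglongrightarrow> 0" by simp
    then show "(\<lambda>k. w k / (1 / real k powr (2 * r))) \<longlonglongrightarrow> 0"
    proof (rule Lim_transform_eventually)
      show "\<forall>\<^sub>F k in sequentially. (real k powr r / t k)\<^sup>2 * ((t k)\<^sup>2 * w k)
          = w k / (1 / real k powr (2 * r))"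
        using eventually_ge_at_top[of 1]
      proof eventually_elim
        case (elim k)
        have "real k powr (2 * r) = (real k powr r)\<^sup>2"
          by (simp add: power2_eq_square powr_add[symmetric])
        then show ?case using t1[OF elim] by (simp add: power_divide)
      qed
    qed
    show "\<forall>\<^sub>F k in sequentially. 1 / real k powr (2 * r) \<noteq> 0"
      using eventually_gt_at_top[of 0] by eventually_elim simp
  qed
  then have small: "(\<lambda>k. real_of_ereal (objective f g (x k) - objective f g xstar))
      \<in> o(\<lambda>k. 1 / real k powr (2 * r))"
    using landau_o.small.in_cong[OF ev_w] by simp
  obtain C where C: "\<forall>\<^sub>F k in sequentially. t k * norm (x k - x (k - 1)) \<le> C"
    using rates(2) by auto
  have big: "(\<lambda>k. norm (x k - x (k - 1))) \<in> O(\<lambda>k. 1 / real k powr r)"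
  proof (rule bigoI)
    show "\<forall>\<^sub>F k in sequentially. norm (norm (x k - x (k - 1)))
        \<le> (2 * a * C) * norm (1 / real k powr r)"
      using C t_ev eventually_gt_at_top[of 0]
    proof eventually_elim
      case (elim k)
      have "real k powr r * norm (x k - x (k - 1)) \<le> 2 * a * t k * norm (x k - x (k - 1))"
        using elim(2) by (rule mult_right_mono) simp
      also have "\<dots> \<le> 2 * a * C" using elim(1) a by (simp add: mult.assoc)
      finally show ?case using elim(3) by (simp add: field_simps)
    qed
  qed
  obtain xbar where xbar: "x \<longlonglongrightarrow> xbar"
    "(\<lambda>k. norm (x k - xbar)) \<in> O(\<lambda>k. 1 / real k powr (r - 1))"
    using convergent_of_powr_increments[OF r big] .
  have "w \<longlonglongrightarrow> 0"
  proof -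
    have "(\<lambda>k. 1 / real k powr (2 * r)) \<in> O(\<lambda>_. 1)" using r by real_asymp
    with w_o have "w \<in> o(\<lambda>_. 1)" by (rule landau_o.small_big_trans)
    from smalloD_tendsto[OF this] show ?thesis by simp
  qed
  then have "(\<lambda>k. w k + F xstar) \<longlonglongrightarrow> 0 + F xstar" by (intro tendsto_intros)
  then have F_lim: "(\<lambda>k. F (x k)) \<longlonglongrightarrow> F xstar" by (simp add: w_def)
  have "\<forall>\<^sub>F k in sequentially. g (x k) \<noteq> \<infinity>"
    using eventually_ge_at_top[of 1] by eventually_elim (rule gx)
  then have "xbar \<in> minimizers (objective f g)"
    by (rule limit_in_minimizers[OF xbar(1) _ F_lim])
  with fin small big xbar show ?thesis by blast
qed

end
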